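(* There is a constant $C_3>0$ such that every graph with $m$ edges has local boxicity at most $C_3\sqrt{m}$. On the other hand, for any function $m=m(n)=\Theta(n^2)$, almost all $n$-vertex graphs with $m$ edges have local boxicity $\Omega(\sqrt{m}/\log m)=\Omega(n/\log n)$; that is, there is a constant $c>0$ such that the proportion of labelled $n$-vertex graphs with $m(n)$ edges having local boxicity at least $c\sqrt{m}/\log m$ tends to $1$ as $n\to\infty$.
   Context: All graphs are finite and simple; $\log$ denotes the binary logarithm. A real interval is either a bounded interval of $\mathbb{R}$ or $\mathbb{R}$ itself. For an integer $d'\ge 1$, a $d'$-box is a Cartesian product $I_1\times\cdots\times I_{d'}$ of real intervals; it is local in dimension $i$ if $I_i$ is bounded. A $d$-local box in dimension $d'\ge d$ is a $d'$-box that is local in at most $d$ dimensions. The local boxicity $\mathrm{lbox}(G)$ of a graph $G$ is the minimum integer $d$ such that, for some $d'$, there are $d$-local boxes $(B_v)_{v\in V(G)}$ in dimension $d'$ such that two distinct vertices $u,v$ are adjacent in $G$ if and only if $B_u\cap B_v\neq\emptyset$.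
   Formalization: The upper bound is stated for m ≥ 1 (edgeless graphs on two or more vertices have local boxicity 1), and the second part assumes m(n) ≤ (1−δ)·C(n,2) eventually for some δ>0, since complete graphs have local boxicity 0; vertices are natural numbers. *)

theory Defs
  imports
    "HOL-Analysis.Analysis"
    "HOL-Library.Landau_Symbols"
begin

definition simple_graph :: "'a set \<Rightarrow> 'a set set \<Rightarrow> bool" where
  "simple_graph V E \<longleftrightarrow> finite V \<and> E \<subseteq> {e. e \<subseteq> V \<and> card e = 2}"

text \<open>
  Intervals are nonempty (open, half-open or closed, possibly a single point). Thus the factors of a
  box are determined by the box, and being local in dimension \<open>i\<close> is a property of the box.
\<close>

definition real_interval :: "real set \<Rightarrow> bool" where
  "real_interval I \<longleftrightarrow> I = UNIV \<or> is_interval I \<and> bounded I \<and> I \<noteq> {}"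

text \<open>
  A box in dimension \<open>d'\<close> is given by its factors \<open>I 0, \<dots>, I (d' - 1)\<close>; the points of
  \<open>d'\<close>-dimensional space are the extensional functions on \<open>{..<d'}\<close>.
\<close>

definition box_of :: "nat \<Rightarrow> (nat \<Rightarrow> real set) \<Rightarrow> (nat \<Rightarrow> real) set" where
  "box_of d' I = (\<Pi>\<^sub>E i\<in>{..<d'}. I i)"

definition local_box :: "nat \<Rightarrow> nat \<Rightarrow> (nat \<Rightarrow> real set) \<Rightarrow> bool" where
  "local_box d d' I \<longleftrightarrow>
     1 \<le> d' \<and> d \<le> d' \<and> (\<forall>i<d'. real_interval (I i)) \<and> card {i. i < d' \<and> bounded (I i)} \<le> d"

definition local_box_rep ::
  "nat \<Rightarrow> nat \<Rightarrow> 'a set \<Rightarrow> 'a set set \<Rightarrow> ('a \<Rightarrow> nat \<Rightarrow> real set) \<Rightarrow> bool" where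
  "local_box_rep d d' V E I \<longleftrightarrow>
     (\<forall>v\<in>V. local_box d d' (I v)) \<and>
     (\<forall>u\<in>V. \<forall>v\<in>V. u \<noteq> v \<longrightarrow> ({u, v} \<in> E \<longleftrightarrow> box_of d' (I u) \<inter> box_of d' (I v) \<noteq> {}))"

definition lbox :: "'a set \<Rightarrow> 'a set set \<Rightarrow> nat" where
  "lbox V E = (LEAST d. \<exists>d' I. local_box_rep d d' V E I)"

text \<open>The labelled graphs with vertex set \<open>{0, \<dots>, n - 1}\<close> and \<open>k\<close> edges, given by their edge sets.\<close>

definition labelled_graphs :: "nat \<Rightarrow> nat \<Rightarrow> nat set set set" where
  "labelled_graphs n k = {E. simple_graph {..<n} E \<and> card E = k}"

text \<open>The minimum in the definition of \<^const>\<open>lbox\<close> is taken over a nonempty set.\<close>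

lemma local_box_rep_exists:
  assumes "simple_graph V E"
  shows "\<exists>d d' I. local_box_rep d d' V E I"
proof -
  have fin: "finite V"
    using assms by (simp add: simple_graph_def)
  obtain f :: "'a \<Rightarrow> nat" where f: "bij_betw f V {0..<card V}"
    using ex_bij_betw_finite_nat[OF fin] by blast
  have inj: "u = v" if "u \<in> V" "v \<in> V" "f u = f v" for u v
    using f that by (auto simp: bij_betw_def inj_on_def)
  have lt: "f v < card V" if "v \<in> V" for v
    using f that by (auto simp: bij_betw_def)
  define w where "w = inv_into V f"
  have w: "w (f v) = v" if "v \<in> V" for v
    using f that by (simp add: w_def bij_betw_def)
  define n where "n = card V"
  define I where "I v i = (if f v = i then {0::real} else if {v, w i} \<in> E then {0..1} else {1})"
    for v i
  define D where "D = max 1 n"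
  have int: "real_interval (I v i)" for v i
    using is_interval_cc[of "0::real" 0] is_interval_cc[of "1::real" 1]
    by (auto simp: I_def real_interval_def is_interval_cc)
  have card: "card {i. i < D \<and> bounded (I v i)} \<le> D" for v
  proof -
    have "card {i. i < D \<and> bounded (I v i)} \<le> card {..<D}"
      by (rule card_mono) auto
    then show ?thesis by simp
  qed
  have "{u, v} \<in> E \<longleftrightarrow> box_of D (I u) \<inter> box_of D (I v) \<noteq> {}"
    if u: "u \<in> V" and v: "v \<in> V" and ne: "u \<noteq> v" for u v
  proof
    assume e: "{u, v} \<in> E"
    then have e': "{v, u} \<in> E" by (simp add: insert_commute)
    have fne: "f u \<noteq> f v" using inj[OF u v] ne by blast
    define p where "p = (\<lambda>i\<in>{..<D}. if i = f u \<or> i = f v then 0 else 1::real)"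
    have "p \<in> box_of D (I u)" "p \<in> box_of D (I v)"
      using e e' fne w[OF u] w[OF v] by (auto simp: box_of_def p_def I_def PiE_iff)
    then show "box_of D (I u) \<inter> box_of D (I v) \<noteq> {}" by blast
  next
    assume "box_of D (I u) \<inter> box_of D (I v) \<noteq> {}"
    then obtain p where p: "p \<in> box_of D (I u)" "p \<in> box_of D (I v)" by blast
    have fne: "f u \<noteq> f v" using inj[OF u v] ne by blast
    have "f u < D" using lt[OF u] by (simp add: D_def n_def)
    then have "p (f u) \<in> I u (f u)" "p (f u) \<in> I v (f u)"
      using p by (auto simp: box_of_def PiE_iff)
    then have "{v, u} \<in> E"
      using fne w[OF u] by (auto simp: I_def split: if_splits)
    then show "{u, v} \<in> E" by (simp add: insert_commute)
  qed
  moreover have "local_box D D (I v)" for v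
    using int card by (auto simp: local_box_def D_def)
  ultimately have "local_box_rep D D V E I"
    by (simp add: local_box_rep_def)
  then show ?thesis by blast
qed

text \<open>
  Local boxicity is invariant under isomorphism, so that a statement about all graphs with vertices
  in \<^typ>\<open>nat\<close> is a statement about all finite graphs.
\<close>

lemma lbox_iso:
  assumes f: "bij_betw f V W" and E: "E \<subseteq> {e. e \<subseteq> V \<and> card e = 2}"
  shows "lbox W ((`) f ` E) = lbox V E"
proof -
  have edge: "{f u, f v} \<in> (`) f ` E \<longleftrightarrow> {u, v} \<in> E" if "u \<in> V" "v \<in> V" for u v
  proof
    assume "{f u, f v} \<in> (`) f ` E"
    then obtain e where e: "e \<in> E" "f ` e = f ` {u, v}" by auto
    have "e \<subseteq> V" using e(1) E by auto
    then have "e = {u, v}"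
      using f e(2) that inj_on_image_eq_iff[of f V e "{u, v}"] by (auto simp: bij_betw_def)
    then show "{u, v} \<in> E" using e(1) by simp
  next
    assume "{u, v} \<in> E"
    then have "f ` {u, v} \<in> (`) f ` E" by (rule imageI)
    then show "{f u, f v} \<in> (`) f ` E" by simp
  qed
  have W: "W = f ` V" and inj: "inj_on f V"
    using f by (auto simp: bij_betw_def)
  have rep: "local_box_rep d d' W ((`) f ` E) J \<longleftrightarrow> local_box_rep d d' V E (J \<circ> f)" for d d' J
    using edge inj by (simp add: local_box_rep_def W inj_on_eq_iff)
  have "(\<exists>d' J. local_box_rep d d' W ((`) f ` E) J) \<longleftrightarrow> (\<exists>d' I. local_box_rep d d' V E I)" for d
  proof
    assume "\<exists>d' J. local_box_rep d d' W ((`) f ` E) J"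
    then show "\<exists>d' I. local_box_rep d d' V E I" using rep by blast
  next
    assume "\<exists>d' I. local_box_rep d d' V E I"
    then obtain d' I where I: "local_box_rep d d' V E I" by blast
    have "((I \<circ> inv_into V f) \<circ> f) v = I v" if "v \<in> V" for v
      using inj that by simp
    then have "local_box_rep d d' V E ((I \<circ> inv_into V f) \<circ> f)"
      using I by (simp add: local_box_rep_def)
    then show "\<exists>d' J. local_box_rep d d' W ((`) f ` E) J" using rep by blast
  qed
  then show ?thesis by (simp add: lbox_def)
qed

text \<open>
  A box that is local in no dimension is the whole space, so an edgeless graph on two or more
  vertices has positive local boxicity and an upper bound of order \<open>sqrt m\<close> needs \<open>m \<ge> 1\<close>;
  complete graphs have local boxicity 0, so a lower bound for dense graphs needs the number of edges
  to stay away from \<open>n choose 2\<close>.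
\<close>

lemma lbox_edgeless_pos:
  assumes "finite V" "u \<in> V" "v \<in> V" "u \<noteq> v"
  shows "0 < lbox V {}"
proof (rule ccontr)
  assume "\<not> 0 < lbox V {}"
  have "simple_graph V {}" using assms(1) by (simp add: simple_graph_def)
  from LeastI_ex[OF local_box_rep_exists[OF this]]
  have "\<exists>d' I. local_box_rep (lbox V {}) d' V {} I" unfolding lbox_def .
  with \<open>\<not> 0 < lbox V {}\<close>
  obtain d' I where rep: "local_box_rep 0 d' V {} I" by auto
  have univ: "I x i = UNIV" if "x \<in> V" "i < d'" for x i
  proof -
    have x: "local_box 0 d' (I x)" using rep that(1) by (simp add: local_box_rep_def)
    then have "{i. i < d' \<and> bounded (I x i)} = {}" by (simp add: local_box_def)
    then show ?thesis using x that(2) by (auto simp: local_box_def real_interval_def)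
  qed
  have "(\<lambda>i\<in>{..<d'}. 0) \<in> box_of d' (I u) \<inter> box_of d' (I v)"
    using univ assms by (auto simp: box_of_def)
  then show False using rep assms by (auto simp: local_box_rep_def)
qed

lemma lbox_complete: "lbox V {e. e \<subseteq> V \<and> card e = 2} = 0"
proof -
  have "local_box_rep 0 1 V {e. e \<subseteq> V \<and> card e = 2} (\<lambda>_ _. UNIV)"
    by (auto simp: local_box_rep_def local_box_def real_interval_def box_of_def PiE_eq_empty_iff)
  then show ?thesis
    unfolding lbox_def by (intro Least_eq_0) blast
qed

end

theory Submission
  imports Defs "HOL-Combinatorics.Permutations" "HOL-Real_Asymp.Real_Asymp"
begin

text \<open>
  Representing a graph by boxes amounts to choosing interval supergraphs so that every non-edge is
  separated in one of them; a vertex is local in those where its interval is bounded.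

  Upper bound: isolated vertices are separated from all others by one interval supergraph, which
  leaves at most \<open>2 m\<close> vertices. With \<open>D = sqrt m\<close> and \<open>t\<close> of order \<open>log m\<close>, the non-edges at a vertex of
  degree at most \<open>D / t\<close> are separated by \<open>O(D)\<close> interval supergraphs coming from vertex
  orderings, since \<open>v\<close> comes last in \<open>N[u] \<union> {v}\<close> in a proportion at least \<open>1 / (deg u + 2)\<close>
  of all orderings. There are at most \<open>2 D t\<close> vertices of larger degree. Split them into groups
  of size \<open>t\<close>; for each group \<open>T\<close> and \<open>R \<subseteq> T\<close>, one supergraph separates \<open>R\<close> from the vertices whose
  non-neighbours in \<open>T\<close> are exactly \<open>R\<close>. A vertex is local in one of these for each of the \<open>O(D)\<close>
  groups, and in another \<open>2 ^ t\<close> through its own group.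

  Lower bound: a graph of local boxicity at most \<open>d\<close> on \<open>n\<close> vertices is determined by
  \<open>O(n d log n)\<close> bits, whereas there are \<open>exp(\<Omega>(n\<^sup>2))\<close> graphs with \<open>m\<close> edges.
\<close>

subsection \<open>Interval supergraphs\<close>

text \<open>One coordinate of a box representation. It is kept as an assignment of intervals rather
  than as a graph, because the number of coordinates with a bounded interval at a given vertex has
  to be counted.\<close>

definition interval_supergraph :: "'a set \<Rightarrow> 'a set set \<Rightarrow> ('a \<Rightarrow> real set) \<Rightarrow> bool" where
  "interval_supergraph V E f \<longleftrightarrow>
     (\<forall>v\<in>V. real_interval (f v)) \<and> (\<forall>u\<in>V. \<forall>v\<in>V. {u, v} \<in> E \<longrightarrow> f u \<inter> f v \<noteq> {})"

lemma box_of_Int_nonempty_iff: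
  "box_of d' I \<inter> box_of d' J \<noteq> {} \<longleftrightarrow> (\<forall>i<d'. I i \<inter> J i \<noteq> {})"
  by (auto simp: box_of_def PiE_Int PiE_eq_empty_iff)

lemma real_interval_nonempty: "real_interval I \<Longrightarrow> I \<noteq> {}"
  by (auto simp: real_interval_def)

lemma real_interval_UNIV [simp]: "real_interval UNIV"
  by (simp add: real_interval_def)

lemma real_interval_atLeastAtMost: "a \<le> b \<Longrightarrow> real_interval {a..b}"
  by (simp add: real_interval_def is_interval_cc)

lemma real_interval_singleton [simp]: "real_interval {a}"
  using real_interval_atLeastAtMost[of a a] by simp

text \<open>Boxes meet exactly when all their factors do, so the members of \<open>F\<close> can
  serve as the dimensions: edges survive in each of them and each non-edge is destroyed by
  one.\<close>

lemma lbox_le: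
  assumes "finite F" and F: "\<And>f. f \<in> F \<Longrightarrow> interval_supergraph V E f"
    and sep: "\<And>u v. u \<in> V \<Longrightarrow> v \<in> V \<Longrightarrow> u \<noteq> v \<Longrightarrow> {u, v} \<notin> E \<Longrightarrow> \<exists>f\<in>F. f u \<inter> f v = {}"
    and loc: "\<And>v. v \<in> V \<Longrightarrow> card {f \<in> F. bounded (f v)} \<le> d"
  shows "lbox V E \<le> d"
proof -
  obtain g where g: "bij_betw g {..<card F} F"
    using ex_bij_betw_nat_finite[OF \<open>finite F\<close>] by (auto simp: atLeast0LessThan)
  \<comment> \<open>The \<open>d + 1\<close> surplus dimensions carry \<open>UNIV\<close>. They add
    no locality and guarantee \<open>1 \<le> D\<close> and \<open>d \<le> D\<close>, as
    \<open>local_box\<close> demands.\<close>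
  define D where "D = card F + d + 1"
  define I where "I v i = (if i < card F then g i v else UNIV)" for v i
  have gF: "g i \<in> F" if "i < card F" for i
    using g that by (auto simp: bij_betw_def)
  have ri: "real_interval (I v i)" if "v \<in> V" for v i
    using F[OF gF] that by (auto simp: I_def interval_supergraph_def)
  have "card {i. i < D \<and> bounded (I v i)} \<le> d" if "v \<in> V" for v
  proof -
    have "card {i. i < D \<and> bounded (I v i)} \<le> card {f \<in> F. bounded (f v)}"
    proof (rule card_inj_on_le)
      show "inj_on g {i. i < D \<and> bounded (I v i)}"
        using g by (auto simp: bij_betw_def I_def inj_on_def not_bounded_UNIV split: if_splits)
      show "g ` {i. i < D \<and> bounded (I v i)} \<subseteq> {f \<in> F. bounded (f v)}"
        using gF by (auto simp: I_def not_bounded_UNIV split: if_splits)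
    qed (use \<open>finite F\<close> in auto)
    then show ?thesis using loc[OF that] by simp
  qed
  moreover have "{u, v} \<in> E \<longleftrightarrow> (\<forall>i<D. I u i \<inter> I v i \<noteq> {})"
    if "u \<in> V" "v \<in> V" "u \<noteq> v" for u v
  proof
    assume e: "{u, v} \<in> E"
    show "\<forall>i<D. I u i \<inter> I v i \<noteq> {}"
      using F[OF gF] that e by (auto simp: I_def interval_supergraph_def)
  next
    assume *: "\<forall>i<D. I u i \<inter> I v i \<noteq> {}"
    show "{u, v} \<in> E"
    proof (rule ccontr)
      assume "{u, v} \<notin> E"
      then obtain f where f: "f \<in> F" "f u \<inter> f v = {}" using sep \<open>u \<in> V\<close> \<open>v \<in> V\<close> \<open>u \<noteq> v\<close> by blast
      then obtain i where i: "i < card F" "f = g i" using g by (auto simp: bij_betw_def)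
      have "i < D" using i by (simp add: D_def)
      then have "I u i \<inter> I v i \<noteq> {}" using * by blast
      then show False using f i by (simp add: I_def)
    qed
  qed
  ultimately have "local_box_rep d D V E I"
    using ri by (simp add: local_box_rep_def local_box_def box_of_Int_nonempty_iff D_def)
  then have "\<exists>d' I. local_box_rep d d' V E I" by blast
  then show ?thesis unfolding lbox_def by (rule Least_le)
qed

section \<open>Separating the non-edges at low-degree vertices by vertex orderings\<close>

text \<open>Double counting shows that some \<omega> covers at least a proportion
  \<open>1 / k\<close> of the points still uncovered. Adding it to \<open>W\<close> multiplies their
  number by at most \<open>1 - 1 / k\<close>.\<close>

lemma greedy_cover:
  fixes k :: nat
  assumes "finite P" "finite \<Omega>" "\<Omega> \<noteq> {}" "k \<ge> 1"
    and cov: "\<And>p. p \<in> P \<Longrightarrow> card \<Omega> \<le> k * card {\<omega> \<in> \<Omega>. cov \<omega> p}"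
  shows "\<exists>W \<subseteq> \<Omega>. card W \<le> N \<and>
     real (card {p \<in> P. \<forall>\<omega>\<in>W. \<not> cov \<omega> p}) \<le> real (card P) * (1 - 1 / real k) ^ N"
proof (induction N)
  case 0
  show ?case by (rule exI[of _ "{}"]) simp
next
  case (Suc N)
  then obtain W where W: "W \<subseteq> \<Omega>" "card W \<le> N"
    "real (card {p \<in> P. \<forall>\<omega>\<in>W. \<not> cov \<omega> p}) \<le> real (card P) * (1 - 1 / real k) ^ N" by blast
  define Q where "Q = {p \<in> P. \<forall>\<omega>\<in>W. \<not> cov \<omega> p}"
  have "finite Q" "Q \<subseteq> P" using \<open>finite P\<close> by (auto simp: Q_def)
  show ?case
  proof (cases "Q = {}")
    case True
    then have "real (card {p \<in> P. \<forall>\<omega>\<in>W. \<not> cov \<omega> p}) \<le> real (card P) * (1 - 1 / real k) ^ Suc N"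
      using \<open>k \<ge> 1\<close> unfolding Q_def[symmetric] by simp
    then show ?thesis using W by (intro exI[of _ W]) auto
  next
    case False
    have "card \<Omega> * card Q = (\<Sum>p\<in>Q. card \<Omega>)" by simp
    also have "\<dots> \<le> (\<Sum>p\<in>Q. k * card {\<omega> \<in> \<Omega>. cov \<omega> p})"
      using cov \<open>Q \<subseteq> P\<close> by (intro sum_mono) blast
    also have "\<dots> = k * (\<Sum>p\<in>Q. card {\<omega> \<in> \<Omega>. cov \<omega> p})"
      by (simp add: sum_distrib_left)
    also have "(\<Sum>p\<in>Q. card {\<omega> \<in> \<Omega>. cov \<omega> p}) = (\<Sum>\<omega>\<in>\<Omega>. card {p \<in> Q. cov \<omega> p})"
      using sum_multicount_gen[OF \<open>finite Q\<close> \<open>finite \<Omega>\<close>, of "\<lambda>p \<omega>. cov \<omega> p" "\<lambda>\<omega>. card {p \<in> Q. cov \<omega> p}"]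
      by simp
    finally have *: "card \<Omega> * card Q \<le> k * (\<Sum>\<omega>\<in>\<Omega>. card {p \<in> Q. cov \<omega> p})" .
    have "\<exists>\<omega>\<in>\<Omega>. card Q \<le> k * card {p \<in> Q. cov \<omega> p}"
    proof (rule ccontr)
      assume "\<not> ?thesis"
      then have "(\<Sum>\<omega>\<in>\<Omega>. k * card {p \<in> Q. cov \<omega> p}) < (\<Sum>\<omega>\<in>\<Omega>. card Q)"
        using \<open>\<Omega> \<noteq> {}\<close> \<open>finite \<Omega>\<close> by (intro sum_strict_mono) auto
      then show False using * by (simp add: sum_distrib_left)
    qed
    then obtain \<omega> where \<omega>: "\<omega> \<in> \<Omega>" "card Q \<le> k * card {p \<in> Q. cov \<omega> p}" by blast
    define R where "R = {p \<in> P. \<forall>\<omega>'\<in>insert \<omega> W. \<not> cov \<omega>' p}"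
    have "R = Q - {p \<in> Q. cov \<omega> p}" by (auto simp: R_def Q_def)
    then have "card R = card Q - card {p \<in> Q. cov \<omega> p}"
      using \<open>finite Q\<close> by (simp add: card_Diff_subset)
    moreover have "card {p \<in> Q. cov \<omega> p} \<le> card Q"
      using \<open>finite Q\<close> by (intro card_mono) auto
    ultimately have "real (card R) = real (card Q) - real (card {p \<in> Q. cov \<omega> p})" by simp
    moreover have "real (card Q) \<le> real k * real (card {p \<in> Q. cov \<omega> p})"
      using \<omega>(2) by (metis of_nat_le_iff of_nat_mult)
    moreover have "real (card Q) / real k \<le> real (card {p \<in> Q. cov \<omega> p})"
      using calculation(2) \<open>k \<ge> 1\<close> by (simp add: field_simps)
    ultimately have "real (card R) \<le> real (card Q) * (1 - 1 / real k)"
      by (simp add: algebra_simps)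
    also have "\<dots> \<le> (real (card P) * (1 - 1 / real k) ^ N) * (1 - 1 / real k)"
      using W(3) \<open>k \<ge> 1\<close> unfolding Q_def by (intro mult_right_mono) auto
    finally have "real (card R) \<le> real (card P) * (1 - 1 / real k) ^ Suc N" by (simp add: mult_ac)
    moreover have "card (insert \<omega> W) \<le> Suc N"
      using W(2) card_insert_le_m1[of "Suc N" W \<omega>] by (simp add: card_insert_if)
    ultimately show ?thesis using W(1) \<omega>(1) unfolding R_def
      by (intro exI[of _ "insert \<omega> W"]) auto
  qed
qed

text \<open>Symmetry: composing with the transposition of \<open>s\<close> and \<open>v\<close> maps
  the permutations with maximum at \<open>s\<close> injectively to those with maximum at
  \<open>v\<close>. The classes for \<open>s \<in> S\<close> cover all permutations; ties may make
  them overlap, but a union bound suffices.\<close>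

lemma card_permutes_le_max_at:
  fixes h :: "'a \<Rightarrow> real"
  assumes "finite V" "S \<subseteq> V" "v \<in> S"
  shows "card {p. p permutes V} \<le> card S * card {p. p permutes V \<and> (\<forall>x\<in>S. h (p x) \<le> h (p v))}"
proof -
  define A where "A s = {p. p permutes V \<and> (\<forall>x\<in>S. h (p x) \<le> h (p s))}" for s
  have finS: "finite S" using assms finite_subset by blast
  have finA: "finite (A s)" for s
    by (rule finite_subset[OF _ finite_permutations[OF \<open>finite V\<close>]]) (auto simp: A_def)
  have "card (A s) \<le> card (A v)" if "s \<in> S" for s
  proof (rule card_inj_on_le)
    show "inj_on (\<lambda>p. p \<circ> Transposition.transpose s v) (A s)"
      by (rule inj_onI) (metis comp_assoc comp_id transpose_comp_involutory)
    show "(\<lambda>p. p \<circ> Transposition.transpose s v) ` A s \<subseteq> A v"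
    proof clarify
      fix p assume p: "p \<in> A s"
      have "Transposition.transpose s v permutes V" using that assms by (intro permutes_swap_id) auto
      then have "p \<circ> Transposition.transpose s v permutes V"
        using p by (intro permutes_compose) (auto simp: A_def)
      moreover have "Transposition.transpose s v x \<in> S" if "x \<in> S" for x
        using that \<open>s \<in> S\<close> \<open>v \<in> S\<close> by (auto simp: Transposition.transpose_def)
      ultimately show "p \<circ> Transposition.transpose s v \<in> A v"
        using p by (auto simp: A_def)
    qed
  qed (rule finA)
  then have "(\<Sum>s\<in>S. card (A s)) \<le> card S * card (A v)"
    using sum_bounded_above[of S "\<lambda>s. card (A s)" "card (A v)"] by simp
  moreover have "{p. p permutes V} \<subseteq> (\<Union>s\<in>S. A s)"
  proof clarify
    fix p assume p: "p permutes V"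
    have "Max ((\<lambda>x. h (p x)) ` S) \<in> (\<lambda>x. h (p x)) ` S"
      using finS \<open>v \<in> S\<close> by (intro Max_in) auto
    then obtain s where "s \<in> S" "Max ((\<lambda>x. h (p x)) ` S) = h (p s)" by auto
    then have "\<forall>x\<in>S. h (p x) \<le> h (p s)" using finS by (metis Max_ge finite_imageI imageI)
    then show "p \<in> (\<Union>s\<in>S. A s)" using \<open>s \<in> S\<close> p by (auto simp: A_def)
  qed
  then have "card {p. p permutes V} \<le> card (\<Union>s\<in>S. A s)"
    using finS finA by (intro card_mono) auto
  then have "card {p. p permutes V} \<le> (\<Sum>s\<in>S. card (A s))"
    using card_UN_le[OF finS, of A] by linarith
  ultimately show ?thesis unfolding A_def by linarith
qed

text \<open>The interval supergraph of a vertex ordering: each vertex lives from its own position to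
  that of its last neighbour. It separates \<open>u\<close> from every \<open>v\<close> placed after
  \<open>u\<close> and all neighbours of \<open>u\<close>. Vertices outside \<open>U\<close> are not
  local.\<close>

definition order_interval :: "'a set \<Rightarrow> 'a set set \<Rightarrow> ('a \<Rightarrow> real) \<Rightarrow> 'a \<Rightarrow> real set" where
  "order_interval U E g v =
     (if v \<in> U then {g v..Max (g ` insert v {w \<in> U. {v, w} \<in> E})} else UNIV)"

text \<open>For an edge inside \<open>U\<close>, the position of the later end lies in both
  intervals.\<close>

lemma interval_supergraph_order_interval:
  assumes "finite U"
  shows "interval_supergraph V E (order_interval U E g)"
proof -
  have fin: "finite (g ` insert v {w \<in> U. {v, w} \<in> E})" for v
    using assms by simp
  have ge: "g x \<le> Max (g ` insert v {w \<in> U. {v, w} \<in> E})"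
    if "x \<in> insert v {w \<in> U. {v, w} \<in> E}" for x v
    using that by (intro Max_ge[OF fin] imageI)
  have ri: "real_interval (order_interval U E g v)" for v
    using ge[of v v] by (simp add: order_interval_def real_interval_atLeastAtMost)
  have "order_interval U E g u \<inter> order_interval U E g v \<noteq> {}" if "{u, v} \<in> E" for u v
  proof (cases "u \<in> U \<and> v \<in> U")
    case True
    then have "{max (g u) (g v)} \<subseteq> order_interval U E g u \<inter> order_interval U E g v"
      using ge[of u u] ge[of v v] ge[of u v] ge[of v u] that
      by (auto simp: order_interval_def insert_commute max_def)
    then show ?thesis by blast
  next
    case False
    then show ?thesis using real_interval_nonempty[OF ri[of u]] real_interval_nonempty[OF ri[of v]]
      by (auto simp: order_interval_def)
  qed
  then show ?thesis using ri by (simp add: interval_supergraph_def)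
qed

text \<open>An ordering separates \<open>u\<close> from \<open>v\<close> if \<open>v\<close> comes
  last among \<open>v\<close>, \<open>u\<close> and the neighbours of \<open>u\<close>. These are at
  most \<open>\<Delta> + 2\<close> vertices, so \<open>greedy_cover\<close> applies with
  \<open>k = \<Delta> + 2\<close>. The condition on \<open>N\<close> says that fewer than one pair
  survives \<open>N\<close> choices.\<close>

lemma low_degree_cover:
  assumes "finite U"
    and deg: "\<And>u. u \<in> L \<Longrightarrow> card {w \<in> U. {u, w} \<in> E} \<le> \<Delta>"
    and N: "real (card U) ^ 2 * (1 - 1 / real (\<Delta> + 2)) ^ N < 1"
  obtains F where "finite F" "card F \<le> N" "\<And>f. f \<in> F \<Longrightarrow> interval_supergraph V E f"
    "\<And>u v. u \<in> L \<Longrightarrow> u \<in> U \<Longrightarrow> v \<in> U \<Longrightarrow> u \<noteq> v \<Longrightarrow> {u, v} \<notin> E \<Longrightarrow> \<exists>f\<in>F. f u \<inter> f v = {}"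
proof -
  obtain h0 :: "'a \<Rightarrow> nat" where "inj_on h0 U"
    using finite_imp_inj_to_nat_seg[OF \<open>finite U\<close>] by blast
  \<comment> \<open>A fixed injective numbering of \<open>U\<close>; each permutation
    \<open>p\<close> of \<open>U\<close> then yields the ordering \<open>h \<circ> p\<close>.
    Injectivity later turns the weak inequalities in \<open>cov\<close> into strict ones.\<close>
  define h where "h v = real (h0 v)" for v
  have h: "inj_on h U" using \<open>inj_on h0 U\<close> by (auto simp: h_def inj_on_def)
  define P where "P = {(u, v). u \<in> L \<inter> U \<and> v \<in> U \<and> u \<noteq> v \<and> {u, v} \<notin> E}"
  define S where "S = (\<lambda>(u, v). insert v (insert u {w \<in> U. {u, w} \<in> E}))"
  define \<Omega> where "\<Omega> = {p. p permutes U}"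
  define cov where "cov p = (\<lambda>(u, v). \<forall>x\<in>S (u, v). h (p x) \<le> h (p v))" for p
  have "P \<subseteq> U \<times> U" by (auto simp: P_def)
  then have "finite P" "card P \<le> card U ^ 2"
    using \<open>finite U\<close> finite_subset[of P "U \<times> U"] card_mono[of "U \<times> U" P]
    by (auto simp: card_cartesian_product power2_eq_square)
  have \<Omega>: "finite \<Omega>" "\<Omega> \<noteq> {}"
    using finite_permutations[OF \<open>finite U\<close>] permutes_id[of U] unfolding \<Omega>_def by blast+
  have "card \<Omega> \<le> (\<Delta> + 2) * card {p \<in> \<Omega>. cov p uv}" if "uv \<in> P" for uv
  proof -
    obtain u v where uv: "uv = (u, v)" by fastforce
    have *: "u \<in> L" "u \<in> U" "v \<in> U" using that uv by (auto simp: P_def)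
    have "card \<Omega> \<le> card (S (u, v)) * card {p \<in> \<Omega>. cov p uv}"
      using card_permutes_le_max_at[OF \<open>finite U\<close>, of "S (u, v)" v h] *
      by (auto simp: \<Omega>_def cov_def S_def uv)
    moreover have "card (S (u, v)) \<le> \<Delta> + 2"
      using deg[OF *(1)] \<open>finite U\<close> by (auto simp: S_def card_insert_if)
    ultimately show ?thesis by (meson le_trans mult_le_mono1)
  qed
  from greedy_cover[of P \<Omega> "\<Delta> + 2" cov N, OF \<open>finite P\<close> \<Omega> _ this]
  obtain W where W: "W \<subseteq> \<Omega>" "card W \<le> N" and
    unc: "real (card {uv \<in> P. \<forall>p\<in>W. \<not> cov p uv}) \<le> real (card P) * (1 - 1 / real (\<Delta> + 2)) ^ N"
    by auto
  have "real (card P) * (1 - 1 / real (\<Delta> + 2)) ^ N \<le> real (card U) ^ 2 * (1 - 1 / real (\<Delta> + 2)) ^ N"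
    using \<open>card P \<le> card U ^ 2\<close> by (intro mult_right_mono) (auto simp flip: of_nat_power)
  with unc N have "card {uv \<in> P. \<forall>p\<in>W. \<not> cov p uv} = 0" by linarith
  then have empty: "{uv \<in> P. \<forall>p\<in>W. \<not> cov p uv} = {}" using \<open>finite P\<close> by simp
  have "finite W" using W(1) \<Omega>(1) finite_subset by blast
  define F where "F = (\<lambda>p. order_interval U E (h \<circ> p)) ` W"
  show ?thesis
  proof
    show "finite F" "card F \<le> N"
      using \<open>finite W\<close> W(2) card_image_le[of W] le_trans unfolding F_def by blast+
    show "interval_supergraph V E f" if "f \<in> F" for f
      using that interval_supergraph_order_interval[OF \<open>finite U\<close>] by (auto simp: F_def)
    fix u v assume uv: "u \<in> L" "u \<in> U" "v \<in> U" "u \<noteq> v" "{u, v} \<notin> E"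
    then have "(u, v) \<in> P" by (simp add: P_def)
    then obtain p where p: "p \<in> W" "cov p (u, v)" using empty by blast
    have perm: "p permutes U" using p(1) W(1) by (auto simp: \<Omega>_def)
    have less: "(h \<circ> p) x < (h \<circ> p) v" if "x \<in> insert u {w \<in> U. {u, w} \<in> E}" for x
    proof -
      have "x \<in> U" "x \<noteq> v" using that uv by auto
      then have "p x \<noteq> p v" using perm by (meson permutes_inj injD)
      moreover have "p x \<in> U" "p v \<in> U" using perm \<open>x \<in> U\<close> uv(3) by (auto simp: permutes_in_image)
      ultimately have "h (p x) \<noteq> h (p v)" using h by (auto dest: inj_onD)
      moreover have "h (p x) \<le> h (p v)" using p(2) that by (auto simp: cov_def S_def)
      ultimately show ?thesis by simp
    qed
    have "Max ((h \<circ> p) ` insert u {w \<in> U. {u, w} \<in> E}) < (h \<circ> p) v"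
      using \<open>finite U\<close> less by (subst Max_less_iff) auto
    then have "order_interval U E (h \<circ> p) u \<inter> order_interval U E (h \<circ> p) v = {}"
      using uv by (auto simp: order_interval_def)
    then show "\<exists>f\<in>F. f u \<inter> f v = {}" using p(1) by (auto simp: F_def)
  qed
qed

section \<open>Separating the non-edges between high-degree vertices\<close>

text \<open>For a group \<open>T j\<close> and \<open>R \<subseteq> T j\<close>, the vertices whose
  non-neighbours in \<open>T j\<close> are exactly \<open>R\<close> form a biclique of the
  complement together with \<open>R\<close>, and one supergraph separates the two sides. Every
  vertex lies on the first side once per group, and on the second side only for subsets
  \<open>R\<close> of its own group.\<close>

lemma biclique_cover:
  assumes "finite H" "t \<ge> 1"
  obtains F where "finite F" "\<And>f. f \<in> F \<Longrightarrow> interval_supergraph V E f"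
    "\<And>u v. u \<in> H \<Longrightarrow> v \<in> H \<Longrightarrow> u \<noteq> v \<Longrightarrow> {u, v} \<notin> E \<Longrightarrow> \<exists>f\<in>F. f u \<inter> f v = {}"
    "\<And>v. card {f \<in> F. bounded (f v)} \<le> card H div t + 1 + 2 ^ t"
proof -
  obtain b where b: "bij_betw b H {..<card H}"
    using ex_bij_betw_finite_nat[OF \<open>finite H\<close>] by (auto simp: atLeast0LessThan)
  define T where "T j = {v \<in> H. b v div t = j}" for j
  define M where "M v j = {x \<in> T j. x \<noteq> v \<and> {v, x} \<notin> E}" for v j
  \<comment> \<open>The two bounded cases exclude each other, since \<open>v \<notin> M v j\<close>.
    The sides sit at the points 0 and 1; all other vertices are not local.\<close>
  define f where "f = (\<lambda>(j, R) v. if v \<in> H \<and> M v j = R then {0} else if v \<in> R then {1} else (UNIV :: real set))"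
  define J where "J = Sigma {0..card H div t} (\<lambda>j. Pow (T j))"
  have finT: "finite (T j)" for j using \<open>finite H\<close> by (simp add: T_def)
  have cardT: "card (T j) \<le> t" for j
  proof -
    have "card (T j) \<le> card {j * t..<j * t + t}"
    proof (rule card_inj_on_le)
      show "inj_on b (T j)" using b by (auto simp: T_def bij_betw_def inj_on_def)
      have "b v \<in> {j * t..<j * t + t}" if "b v div t = j" for v
        proof -
        have "j * t + b v mod t = b v" using that div_mult_mod_eq[of "b v" t] by simp
        moreover have "b v mod t < t" using \<open>t \<ge> 1\<close> by simp
        ultimately show ?thesis unfolding atLeastLessThan_iff by linarith
      qed
      then show "b ` T j \<subseteq> {j * t..<j * t + t}" by (auto simp: T_def)
    qed simp
    then show ?thesis by simp
  qed
  have finJ: "finite J" using finT by (auto simp: J_def)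
  have group: "b v div t \<le> card H div t" if "v \<in> H" for v
    using b that by (intro div_le_mono less_imp_le) (auto simp: bij_betw_def)
  show ?thesis
  proof
    show "finite (f ` J)" using finJ by simp
    show "interval_supergraph V E g" if "g \<in> f ` J" for g
    proof -
      from that obtain j R where g: "g = f (j, R)" by auto
      have "f (j, R) u \<inter> f (j, R) v \<noteq> {}" if "{u, v} \<in> E" for u v
      proof -
        have "M u j = R \<Longrightarrow> v \<notin> R" "M v j = R \<Longrightarrow> u \<notin> R"
          using that by (auto simp: M_def insert_commute)
        then show ?thesis by (auto simp: f_def)
      qed
      moreover have "real_interval (f (j, R) v)" for v by (simp add: f_def)
      ultimately show ?thesis by (simp add: interval_supergraph_def g)
    qed
    show "\<exists>g\<in>f ` J. g u \<inter> g v = {}" if uv: "u \<in> H" "v \<in> H" "u \<noteq> v" "{u, v} \<notin> E" for u v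
    proof -
      define j where "j = b v div t"
      have "v \<in> M u j" using uv by (auto simp: M_def T_def j_def)
      moreover have "v \<notin> M v j" by (simp add: M_def)
      ultimately have "f (j, M u j) u \<inter> f (j, M u j) v = {}" using uv by (auto simp: f_def)
      moreover have "(j, M u j) \<in> J" using group[OF uv(2)] by (auto simp: J_def j_def M_def)
      ultimately show ?thesis by blast
    qed
    show "card {g \<in> f ` J. bounded (g v)} \<le> card H div t + 1 + 2 ^ t" for v
    proof -
      \<comment> \<open>\<open>A\<close> collects the indices where \<open>v\<close> may be at 0, so
        that \<open>R\<close> is determined by \<open>j\<close>; \<open>B\<close> those where it may
        be at 1, so that \<open>j\<close> is its own group. The groups are numbered from 0 to
        \<open>card H div t\<close>, the last one being possibly incomplete, hence the
        \<open>+ 1\<close> in the bound.\<close>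
      define A where "A = (\<lambda>j. (j, M v j)) ` {0..card H div t}"
      define B where "B = Pair (b v div t) ` Pow (T (b v div t))"
      have "{g \<in> f ` J. bounded (g v)} \<subseteq> f ` (A \<union> B)"
      proof clarify
        fix j R assume "(j, R) \<in> J" "bounded (f (j, R) v)"
        then consider "M v j = R" "j \<le> card H div t" | "v \<in> R" "R \<subseteq> T j"
          by (auto simp: f_def J_def not_bounded_UNIV split: if_splits)
        then have "(j, R) \<in> A \<union> B"
        proof cases
          case 2
          then have "j = b v div t" by (auto simp: T_def)
          then show ?thesis using 2 by (simp add: B_def)
        qed (auto simp: A_def)
        then show "f (j, R) \<in> f ` (A \<union> B)" by blast
      qed
      moreover have fin: "finite A" "finite B" using finT by (auto simp: A_def B_def)
      ultimately have "card {g \<in> f ` J. bounded (g v)} \<le> card (f ` (A \<union> B))"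
        by (intro card_mono) auto
      also have "\<dots> \<le> card A + card B"
        using fin card_image_le[of "A \<union> B" f] card_Un_le[of A B] by simp
      also have "card A \<le> card H div t + 1"
        unfolding A_def by (rule order_trans[OF card_image_le]) auto
      also have "card B \<le> card (Pow (T (b v div t)))"
        unfolding B_def using finT by (intro card_image_le) auto
      also have "\<dots> = 2 ^ card (T (b v div t))" by (rule card_Pow[OF finT])
      also have "\<dots> \<le> 2 ^ t" using cardT by (intro power_increasing) auto
      finally show ?thesis by simp
    qed
  qed
qed

text \<open>No edge meets \<open>Z\<close>, so its vertices can be placed at distinct points of
  value at least 1, while all remaining vertices share the point 0.\<close>

lemma isolated_cover:
  assumes "finite V" "Z \<inter> \<Union>E = {}"
  obtains f where "interval_supergraph V E f"
    "\<And>u v. u \<in> V \<Longrightarrow> v \<in> V \<Longrightarrow> u \<in> Z \<Longrightarrow> u \<noteq> v \<Longrightarrow> f u \<inter> f v = {}"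
proof -
  obtain h :: "'a \<Rightarrow> nat" where h: "inj_on h V"
    using finite_imp_inj_to_nat_seg[OF \<open>finite V\<close>] by blast
  show ?thesis
  proof
    show "interval_supergraph V E (\<lambda>v. if v \<in> Z then {1 + real (h v)} else {0})"
      using assms by (auto simp: interval_supergraph_def)
  qed (use h in \<open>auto simp: inj_on_def\<close>)
qed

text \<open>A non-edge has an isolated end, or a low-degree end, or two high-degree ends, and each
  kind has its own family. Setting the isolated vertices aside makes the bound independent of
  \<open>card V\<close>. The final \<open>2\<close> counts the incomplete group and the supergraph
  for isolated vertices.\<close>

lemma lbox_le_degree_split:
  fixes \<Delta> t N :: nat
  assumes G: "simple_graph V E" and "t \<ge> 1"
    and N: "real (card (\<Union>E)) ^ 2 * (1 - 1 / real (\<Delta> + 2)) ^ N < 1"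
  shows "lbox V E \<le> N + card {v \<in> \<Union>E. card {w \<in> \<Union>E. {v, w} \<in> E} > \<Delta>} div t + 2 ^ t + 2"
proof -
  define U where "U = \<Union>E"
  define H where "H = {v \<in> U. card {w \<in> U. {v, w} \<in> E} > \<Delta>}"
  have "finite V" "U \<subseteq> V" using G by (auto simp: simple_graph_def U_def)
  then have "finite U" "finite H" using finite_subset[of H U] finite_subset[of U V] by (auto simp: H_def)
  have deg: "card {w \<in> U. {u, w} \<in> E} \<le> \<Delta>" if "u \<in> U - H" for u
    using that by (auto simp: H_def)
  obtain F1 where F1: "finite F1" "card F1 \<le> N" "\<And>f. f \<in> F1 \<Longrightarrow> interval_supergraph V E f"
    "\<And>u v. u \<in> U - H \<Longrightarrow> u \<in> U \<Longrightarrow> v \<in> U \<Longrightarrow> u \<noteq> v \<Longrightarrow> {u, v} \<notin> E \<Longrightarrow> \<exists>f\<in>F1. f u \<inter> f v = {}"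
    by (rule low_degree_cover[OF \<open>finite U\<close> deg N[folded U_def], where V = V]) blast+
  obtain F2 where F2: "finite F2" "\<And>f. f \<in> F2 \<Longrightarrow> interval_supergraph V E f"
    "\<And>u v. u \<in> H \<Longrightarrow> v \<in> H \<Longrightarrow> u \<noteq> v \<Longrightarrow> {u, v} \<notin> E \<Longrightarrow> \<exists>f\<in>F2. f u \<inter> f v = {}"
    "\<And>v. card {f \<in> F2. bounded (f v)} \<le> card H div t + 1 + 2 ^ t"
    by (rule biclique_cover[OF \<open>finite H\<close> \<open>t \<ge> 1\<close>, where V = V and E = E]) blast
  have "(V - U) \<inter> \<Union>E = {}" by (auto simp: U_def)
  then obtain f0 where f0: "interval_supergraph V E f0"
    "\<And>u v. u \<in> V \<Longrightarrow> v \<in> V \<Longrightarrow> u \<in> V - U \<Longrightarrow> u \<noteq> v \<Longrightarrow> f0 u \<inter> f0 v = {}"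
    by (rule isolated_cover[OF \<open>finite V\<close>]) blast
  have "lbox V E \<le> N + (card H div t + 1 + 2 ^ t) + 1"
  proof (rule lbox_le)
    show "finite (F1 \<union> F2 \<union> {f0})" using F1(1) F2(1) by simp
    show "interval_supergraph V E f" if "f \<in> F1 \<union> F2 \<union> {f0}" for f
      using that F1(3) F2(2) f0(1) by blast
    show "\<exists>f\<in>F1 \<union> F2 \<union> {f0}. f u \<inter> f v = {}"
      if uv: "u \<in> V" "v \<in> V" "u \<noteq> v" "{u, v} \<notin> E" for u v
    proof -
      have vu: "{v, u} \<notin> E" "v \<noteq> u" using uv by (auto simp: insert_commute)
      consider "u \<notin> U" | "v \<notin> U" | "u \<in> U" "v \<in> U" "u \<notin> H" | "u \<in> U" "v \<in> U" "v \<notin> H" | "u \<in> H" "v \<in> H"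
        by blast
      then show ?thesis
      proof cases
        case 1
        then show ?thesis using f0(2)[of u v] uv by blast
      next
        case 2
        then show ?thesis using f0(2)[of v u] uv by blast
      next
        case 3
        then show ?thesis using F1(4)[of u v] uv by blast
      next
        case 4
        then show ?thesis using F1(4)[of v u] vu by blast
      next
        case 5
        then show ?thesis using F2(3)[of u v] uv by blast
      qed
    qed
    show "card {f \<in> F1 \<union> F2 \<union> {f0}. bounded (f v)} \<le> N + (card H div t + 1 + 2 ^ t) + 1" for v
    proof -
      have "{f \<in> F1 \<union> F2 \<union> {f0}. bounded (f v)} \<subseteq> F1 \<union> {f \<in> F2. bounded (f v)} \<union> {f0}" by blast
      then have "card {f \<in> F1 \<union> F2 \<union> {f0}. bounded (f v)} \<le> card (F1 \<union> {f \<in> F2. bounded (f v)} \<union> {f0})"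
        using F1(1) F2(1) by (intro card_mono) auto
      also have "\<dots> \<le> card F1 + card {f \<in> F2. bounded (f v)} + card {f0}"
        by (meson add_le_mono card_Un_le le_refl le_trans)
      also have "\<dots> \<le> N + (card H div t + 1 + 2 ^ t) + 1"
        using F1(2) F2(4)[of v] by simp
      finally show ?thesis .
    qed
  qed
  then show ?thesis by (simp add: H_def U_def)
qed

subsection \<open>The upper bound\<close>

lemma sum_card_incident:
  assumes "simple_graph V E"
  shows "(\<Sum>v\<in>\<Union>E. card {e \<in> E. v \<in> e}) = 2 * card E"
proof -
  have V: "finite V" "\<Union>E \<subseteq> V" "E \<subseteq> Pow V" using assms by (auto simp: simple_graph_def)
  then have fin: "finite (\<Union>E)" "finite E" by (meson finite_subset finite_Pow_iff)+
  have "card {v \<in> \<Union>E. v \<in> e} = 2" if "e \<in> E" for e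
  proof -
    have "{v \<in> \<Union>E. v \<in> e} = e" using that by blast
    then show ?thesis using assms that by (auto simp: simple_graph_def)
  qed
  then show ?thesis using sum_multicount[OF fin, of "\<lambda>v e. v \<in> e" 2] by simp
qed

text \<open>Each of these vertices contributes at least \<open>\<Delta> + 1\<close> to the degree
  sum \<open>2 * card E\<close>.\<close>

lemma card_vertices_degree_gt:
  assumes G: "simple_graph V E"
  shows "card {v \<in> \<Union>E. card {w \<in> \<Union>E. {v, w} \<in> E} > \<Delta>} * (\<Delta> + 1) \<le> 2 * card E"
proof -
  define H where "H = {v \<in> \<Union>E. card {w \<in> \<Union>E. {v, w} \<in> E} > \<Delta>}"
  have V: "finite V" "\<Union>E \<subseteq> V" "E \<subseteq> Pow V" using assms by (auto simp: simple_graph_def)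
  then have fin: "finite (\<Union>E)" "finite E" by (meson finite_subset finite_Pow_iff)+
  have "\<Delta> + 1 \<le> card {e \<in> E. v \<in> e}" if "v \<in> H" for v
  proof -
    have "card {w \<in> \<Union>E. {v, w} \<in> E} \<le> card {e \<in> E. v \<in> e}"
    proof (rule card_inj_on_le)
      show "inj_on (\<lambda>w. {v, w}) {w \<in> \<Union>E. {v, w} \<in> E}"
        by (auto simp: inj_on_def doubleton_eq_iff)
    qed (use fin in auto)
    then show ?thesis using that by (simp add: H_def)
  qed
  then have "(\<Sum>v\<in>H. \<Delta> + 1) \<le> (\<Sum>v\<in>H. card {e \<in> E. v \<in> e})" by (rule sum_mono)
  also have "\<dots> \<le> (\<Sum>v\<in>\<Union>E. card {e \<in> E. v \<in> e})"
    using fin by (intro sum_mono2) (auto simp: H_def)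
  finally show ?thesis using sum_card_incident[OF G] by (simp add: H_def)
qed

lemma card_non_isolated_le:
  assumes "simple_graph V E"
  shows "card (\<Union>E) \<le> 2 * card E"
proof -
  have two: "card e = 2" if "e \<in> E" for e using assms that by (auto simp: simple_graph_def)
  have "card (\<Union>E) \<le> (\<Sum>e\<in>E. card e)"
    by (rule card_Union_le_sum_card)
  then show ?thesis using two by simp
qed

text \<open>From \<open>1 - y \<le> exp (- y)\<close>. It supplies the condition on \<open>N\<close>
  in \<open>lbox_le_degree_split\<close>.\<close>

lemma power_one_minus_inverse_less:
  fixes k N :: nat and x :: real
  assumes "k \<ge> 1" "x > 0" "real N > real k * ln x"
  shows "x * (1 - 1 / real k) ^ N < 1"
proof -
  have "(1 - 1 / real k) ^ N \<le> exp (- (1 / real k)) ^ N"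
    using assms(1) exp_ge_add_one_self[of "- (1 / real k)"] by (intro power_mono) auto
  also have "\<dots> = exp (- (real N / real k))" by (simp flip: exp_of_nat_mult)
  also have "\<dots> < exp (- ln x)" using assms by (simp add: field_simps)
  also have "\<dots> = 1 / x" using assms(2) by (simp add: exp_minus divide_simps)
  finally show ?thesis using assms(2) by (simp add: field_simps)
qed

lemma lbox_le_sqrt_edges:
  assumes G: "simple_graph V E" and "card E \<ge> 1"
  shows "real (lbox V E) \<le> 57 * sqrt (real (card E))"
proof -
  define m where "m = card E"
  define D where "D = sqrt (real m)"
  have m: "m \<ge> 1" and D: "D \<ge> 1" "D ^ 2 = real m" using assms(2) by (auto simp: m_def D_def)
  obtain k where k: "2 ^ k \<le> m" "m < 2 ^ (k + 1)" using ex_power_ivl1[of 2 m] m by auto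
  \<comment> \<open>Here \<open>t\<close> has order \<open>log m\<close>, yet \<open>2 ^ t\<close>
    is at most \<open>2 * D\<close>. The threshold \<open>D / t\<close> balances the other two
    costs: \<open>\<Delta> * log m\<close> orderings, and about \<open>m / \<Delta>\<close>
    high-degree vertices in groups of size \<open>t\<close>, are both of order
    \<open>D\<close>.\<close>
  define t where "t = k div 4 + 1"
  define \<Delta> where "\<Delta> = nat \<lfloor>D / real t\<rfloor>"
  \<comment> \<open>The factor \<open>2 * ln (2 * real m)\<close> is the logarithm of
    \<open>(2 * m) ^ 2\<close>, which bounds the number of ordered pairs of non-isolated vertices.
    The \<open>+ 1\<close> makes the inequality strict after rounding down.\<close>
  define N where "N = nat \<lfloor>real (\<Delta> + 2) * (2 * ln (2 * real m))\<rfloor> + 1"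
  define h where "h = card {v \<in> \<Union>E. card {w \<in> \<Union>E. {v, w} \<in> E} > \<Delta>}"
  have t: "t \<ge> 1" "k + 2 \<le> 5 * t" by (auto simp: t_def)
  have \<Delta>: "real \<Delta> \<le> D / real t" "D / real t < real \<Delta> + 1"
    using D by (auto simp: \<Delta>_def)
  have pow: "2 ^ t \<le> 2 * D"
  proof -
    have "(2 ^ (k div 4)) ^ 2 \<le> (2::nat) ^ k"
      by (simp flip: power_mult)
    then have "real ((2 ^ (k div 4)) ^ 2) \<le> real m" using k(1) by (meson le_trans of_nat_le_iff)
    then have "(2 ^ (k div 4)) ^ 2 \<le> D ^ 2" using D by simp
    then have "2 ^ (k div 4) \<le> D" using D(1) power2_le_imp_le[of "2 ^ (k div 4)" D] by simp
    then show ?thesis by (simp add: t_def)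
  qed
  have "real t < 2 ^ t" by (rule of_nat_less_two_power)
  then have tD: "real t \<le> 2 * D" using pow by linarith
  have ln_nonneg: "ln (2 * real m) \<ge> 0" using m by simp
  have "2 * real m < 2 ^ (k + 2)"
  proof -
    have "real m < real (2 ^ (k + 1))" using k(2) by (simp only: of_nat_less_iff)
    then show ?thesis by simp
  qed
  then have "ln (2 * real m) \<le> ln (2 ^ (k + 2))" using m by simp
  also have "\<dots> = real (k + 2) * ln 2" by (rule ln_realpow)
  also have "\<dots> \<le> real (k + 2) * 1" by (intro mult_left_mono) (auto simp: ln_2_less_1 less_imp_le)
  also have "\<dots> \<le> 5 * real t" using t(2) by simp
  finally have ln: "ln (2 * real m) \<le> 5 * real t" .
  have "real N \<le> real (\<Delta> + 2) * (2 * ln (2 * real m)) + 1"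
    using ln_nonneg by (simp add: N_def)
  also have "\<dots> \<le> (D / real t + 2) * (2 * (5 * real t)) + 1"
    using \<Delta>(1) ln ln_nonneg D by (intro add_right_mono mult_mono) auto
  also have "\<dots> = 10 * D + 20 * real t + 1" using t(1) by (simp add: field_simps)
  finally have ND: "real N \<le> 51 * D" using tD D by linarith
  have "real (card (\<Union>E)) ^ 2 * (1 - 1 / real (\<Delta> + 2)) ^ N \<le> (2 * real m) ^ 2 * (1 - 1 / real (\<Delta> + 2)) ^ N"
  proof -
    have "real (card (\<Union>E)) \<le> 2 * real m"
      using card_non_isolated_le[OF G] unfolding m_def by linarith
    then show ?thesis by (intro mult_right_mono power_mono) auto
  qed
  also have "\<dots> < 1"
  proof (rule power_one_minus_inverse_less)
    have "ln ((2 * real m) ^ 2) = 2 * ln (2 * real m)" using m by (subst ln_realpow) auto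
    then show "real N > real (\<Delta> + 2) * ln ((2 * real m) ^ 2)"
      using ln_nonneg unfolding N_def by (simp add: algebra_simps) linarith
  qed (use m in auto)
  finally have "lbox V E \<le> N + h div t + 2 ^ t + 2"
    unfolding h_def by (rule lbox_le_degree_split[OF G t(1)])
  then have "real (lbox V E) \<le> real (N + h div t + 2 ^ t + 2)" by (simp only: of_nat_le_iff)
  moreover have "real (h div t) \<le> 2 * D"
  proof -
    have "h * (\<Delta> + 1) \<le> 2 * m"
      using card_vertices_degree_gt[OF G] by (simp add: h_def m_def)
    then have "real h * (real \<Delta> + 1) \<le> 2 * D ^ 2"
      using D(2) by (metis of_nat_1 of_nat_add of_nat_le_iff of_nat_mult of_nat_numeral)
    moreover have "real h * (D / real t) \<le> real h * (real \<Delta> + 1)"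
      using \<Delta>(2) by (intro mult_left_mono) auto
    ultimately have "(real h / real t) * D \<le> (2 * D) * D" by (simp add: power2_eq_square)
    then have "real h / real t \<le> 2 * D" using D(1) by (metis mult_right_le_imp_le less_le_trans zero_less_one)
    then show ?thesis using of_nat_div_le_of_nat[of h t, where ?'a = real] by linarith
  qed
  \<comment> \<open>\<open>57 = 51 + 2 + 2 + 2\<close>: the orderings, the groups,
    \<open>2 ^ t\<close>, and the summand 2, which is at most \<open>2 * D\<close>.\<close>
  ultimately have "real (lbox V E) \<le> 57 * D" using ND pow D by simp
  then show ?thesis by (simp add: D_def m_def)
qed

subsection \<open>Counting graphs of small local boxicity\<close>

text \<open>Intervals may be open or half-open, so the ranks come from the order "entirely before"
  instead of end points. \<open>l y\<close> counts the intervals before \<open>y\<close>. The sets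
  \<open>Pred y\<close> form a chain, so \<open>r x\<close> is the largest \<open>l\<close> among
  the intervals that \<open>x\<close> does not precede.\<close>

lemma interval_ranks:
  fixes I :: "'a \<Rightarrow> real set"
  assumes "finite X" and I: "\<And>x. x \<in> X \<Longrightarrow> is_interval (I x) \<and> I x \<noteq> {}"
  obtains l r :: "'a \<Rightarrow> nat" where "\<And>x. l x \<le> card X" "\<And>x. r x \<le> card X"
    "\<And>x y. x \<in> X \<Longrightarrow> y \<in> X \<Longrightarrow> I x \<inter> I y \<noteq> {} \<longleftrightarrow> l x \<le> r y \<and> l y \<le> r x"
proof -
  define lt where "lt x y \<longleftrightarrow> (\<forall>a\<in>I x. \<forall>b\<in>I y. a < b)" for x y
  define Pred where "Pred y = {z \<in> X. lt z y}" for y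
  define l where "l y = card (Pred y)" for y
  define r where "r x = card (\<Union>y\<in>{y \<in> X. \<not> lt x y}. Pred y)" for x
  have lt_iff: "lt x y \<longleftrightarrow> r x < l y" if "x \<in> X" "y \<in> X" for x y
  proof (cases "lt x y")
    case True
    \<comment> \<open>If \<open>x\<close> does not precede \<open>z\<close>, then some point of
      \<open>z\<close> is at or below a point of \<open>x\<close>. Whatever precedes
      \<open>z\<close> therefore precedes \<open>y\<close>, and the inclusion is proper because
      \<open>x\<close> itself is missed.\<close>
    have "Pred z \<subseteq> Pred y - {x}" if "\<not> lt x z" for z
    proof -
      from that obtain a c where ac: "a \<in> I x" "c \<in> I z" "c \<le> a" by (auto simp: lt_def not_less)
      then have "lt w y" if "lt w z" for w
        using True that unfolding lt_def by (meson le_less_trans less_trans)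
      then show ?thesis using that by (auto simp: Pred_def)
    qed
    then have "(\<Union>y\<in>{y \<in> X. \<not> lt x y}. Pred y) \<subseteq> Pred y - {x}" by blast
    moreover have "x \<in> Pred y" "finite (Pred y)" using True that \<open>finite X\<close> by (auto simp: Pred_def)
    ultimately have "(\<Union>y\<in>{y \<in> X. \<not> lt x y}. Pred y) \<subset> Pred y" by blast
    then have "r x < l y" unfolding r_def l_def using \<open>finite (Pred y)\<close> by (rule psubset_card_mono[rotated])
    then show ?thesis using True by simp
  next
    case False
    then have "Pred y \<subseteq> (\<Union>y\<in>{y \<in> X. \<not> lt x y}. Pred y)" using that by blast
    then have "l y \<le> r x" unfolding r_def l_def
      by (rule card_mono[rotated]) (use \<open>finite X\<close> in \<open>auto simp: Pred_def\<close>)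
    then show ?thesis using False by simp
  qed
  have disj: "I x \<inter> I y = {} \<longleftrightarrow> lt x y \<or> lt y x" if "x \<in> X" "y \<in> X" for x y
  proof
    assume empty: "I x \<inter> I y = {}"
    show "lt x y \<or> lt y x"
    proof (rule ccontr)
      assume "\<not> (lt x y \<or> lt y x)"
      then obtain a b c d where abcd: "a \<in> I x" "b \<in> I y" "b \<le> a" "c \<in> I y" "d \<in> I x" "d \<le> c"
        unfolding lt_def by (meson not_less)
      have int: "is_interval (I x)" "is_interval (I y)" using I that by auto
      show False
      \<comment> \<open>Convexity enters: either \<open>b\<close> lies between \<open>d\<close> and
        \<open>a\<close> in \<open>I x\<close>, or \<open>d\<close> lies between \<open>b\<close>
        and \<open>c\<close> in \<open>I y\<close>.\<close>
      proof (cases "d \<le> b")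
        case True
        then have "b \<in> I x" using int abcd by (meson is_interval_1)
        then show False using empty abcd by blast
      next
        case False
        then have "d \<in> I y" using int abcd by (meson is_interval_1 le_cases)
        then show False using empty abcd by blast
      qed
    qed
  next
    assume "lt x y \<or> lt y x"
    then show "I x \<inter> I y = {}" by (auto simp: lt_def)
  qed
  show ?thesis
  proof
    show "l x \<le> card X" "r x \<le> card X" for x
      unfolding l_def r_def using \<open>finite X\<close> by (auto simp: Pred_def intro!: card_mono)
    show "I x \<inter> I y \<noteq> {} \<longleftrightarrow> l x \<le> r y \<and> l y \<le> r x" if "x \<in> X" "y \<in> X" for x y
      using disj[OF that] lt_iff[OF that] lt_iff[OF that(2,1)] by auto
  qed
qed

text \<open>Repeating an element pads the list; lists of one fixed length are counted by a plain
  power.\<close>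

lemma list_of_set_length:
  assumes "finite S" "S \<noteq> {}" "card S \<le> k"
  obtains xs where "set xs = S" "length xs = k"
proof -
  obtain ys where ys: "set ys = S" "distinct ys" using finite_distinct_list[OF \<open>finite S\<close>] by blast
  obtain s where "s \<in> S" using \<open>S \<noteq> {}\<close> by blast
  have "length ys \<le> k" using ys assms(3) distinct_card by fastforce
  then have "length (ys @ replicate (k - length ys) s) = k" by simp
  moreover have "set (ys @ replicate (k - length ys) s) = S" using ys \<open>s \<in> S\<close> by auto
  ultimately show ?thesis using that by blast
qed

section \<open>Finite codes for box representations\<close>

text \<open>A triple holds the index of a dimension and the left and right rank of the interval
  there. A dimension missing from either list imposes nothing, just as an unbounded factor
  does.\<close>

definition compatible :: "(nat \<times> nat \<times> nat) list \<Rightarrow> (nat \<times> nat \<times> nat) list \<Rightarrow> bool" where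
  "compatible xs ys \<longleftrightarrow>
     (\<forall>i l r l' r'. (i, l, r) \<in> set xs \<and> (i, l', r') \<in> set ys \<longrightarrow> l \<le> r' \<and> l' \<le> r)"

definition decode_graph :: "nat \<Rightarrow> (nat \<Rightarrow> (nat \<times> nat \<times> nat) list) \<Rightarrow> nat set set" where
  "decode_graph n c = {{u, v} | u v. u < n \<and> v < n \<and> u \<noteq> v \<and> compatible (c u) (c v)}"

definition graph_codes :: "nat \<Rightarrow> nat \<Rightarrow> (nat \<Rightarrow> (nat \<times> nat \<times> nat) list) set" where
  "graph_codes n d =
     (\<Pi>\<^sub>E v\<in>{..<n}. {xs. set xs \<subseteq> {..n * d} \<times> {..n} \<times> {..n} \<and> length xs = d + 1})"

lemma finite_graph_codes: "finite (graph_codes n d)"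
  unfolding graph_codes_def by (intro finite_PiE ballI finite_lists_length_eq) auto

lemma card_graph_codes: "card (graph_codes n d) = ((n * d + 1) * (n + 1)\<^sup>2) ^ ((d + 1) * n)"
  by (simp add: graph_codes_def card_PiE card_lists_length_eq power_mult power2_eq_square del: power_Suc mult_Suc)

text \<open>Only the at most \<open>n * d\<close> dimensions in which some vertex is local matter, and
  in each of them only the order of the interval ends. The dummy triple \<open>(n * d, 0, 0)\<close>
  keeps the codes nonempty, so that they can be padded to a fixed length.\<close>

lemma decode_graph_surj:
  assumes G: "simple_graph {..<n} E" and rep: "local_box_rep d0 d' {..<n} E I" and "d0 \<le> d"
  shows "E \<in> decode_graph n ` graph_codes n d"
proof -
  define B where "B v = {i. i < d' \<and> bounded (I v i)}" for v
  define D where "D = (\<Union>v<n. B v)"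
  have box: "local_box d0 d' (I v)" if "v < n" for v using rep that by (simp add: local_box_rep_def)
  have finB: "finite (B v)" for v by (simp add: B_def)
  have cardB: "card (B v) \<le> d" if "v < n" for v
    using box[OF that] \<open>d0 \<le> d\<close> by (simp add: local_box_def B_def)
  have finD: "finite D" using finB by (simp add: D_def)
  have "card D \<le> (\<Sum>v<n. card (B v))" unfolding D_def by (rule card_UN_le) simp
  also have "\<dots> \<le> n * d" using sum_bounded_above[of "{..<n}" "\<lambda>v. card (B v)" d] cardB by simp
  finally have cardD: "card D \<le> n * d" .
  obtain idx where "bij_betw idx D {..<card D}"
    using ex_bij_betw_finite_nat[OF finD] by (auto simp: atLeast0LessThan)
  then have idx: "inj_on idx D" and "idx ` D = {..<card D}" by (auto simp: bij_betw_def)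
  then have idx_less: "idx i < n * d" if "i \<in> D" for i
  proof -
    have "idx i \<in> {..<card D}" using \<open>idx ` D = {..<card D}\<close> that by blast
    then show ?thesis using cardD by simp
  qed
  have ri: "real_interval (I v i)" if "v < n" "i < d'" for v i
    using box[OF that(1)] that(2) by (simp add: local_box_def)
  have "\<exists>l r. (\<forall>x. l x \<le> n \<and> r x \<le> n) \<and>
      (\<forall>u v. u < n \<longrightarrow> v < n \<longrightarrow> i \<in> B u \<longrightarrow> i \<in> B v \<longrightarrow> (I u i \<inter> I v i \<noteq> {} \<longleftrightarrow> l u \<le> r v \<and> l v \<le> r u))" for i
  proof -
    define X where "X = {v. v < n \<and> i \<in> B v}"
    have "card X \<le> n" using card_mono[of "{..<n}" X] by (auto simp: X_def)
    have "finite X" by (simp add: X_def)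
    moreover have "is_interval (I x i) \<and> I x i \<noteq> {}" if "x \<in> X" for x
      using ri[of x i] that by (auto simp: X_def B_def real_interval_def)
    ultimately obtain l r where "\<And>x. l x \<le> card X" "\<And>x. r x \<le> card X"
      "\<And>x y. x \<in> X \<Longrightarrow> y \<in> X \<Longrightarrow> I x i \<inter> I y i \<noteq> {} \<longleftrightarrow> l x \<le> r y \<and> l y \<le> r x"
      by (rule interval_ranks[of X "\<lambda>x. I x i"]) blast+
    then show ?thesis using \<open>card X \<le> n\<close> unfolding X_def
      by (intro exI[of _ l] exI[of _ r]) (auto intro: le_trans)
  qed
  then obtain l r where lr: "\<And>i x. l i x \<le> n \<and> r i x \<le> n"
    "\<And>i u v. u < n \<Longrightarrow> v < n \<Longrightarrow> i \<in> B u \<Longrightarrow> i \<in> B v \<Longrightarrow>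
       (I u i \<inter> I v i \<noteq> {} \<longleftrightarrow> l i u \<le> r i v \<and> l i v \<le> r i u)"
    by metis
  define s where "s v = insert (n * d, 0, 0) ((\<lambda>i. (idx i, l i v, r i v)) ` B v)" for v
  have "\<exists>xs. set xs = s v \<and> length xs = d + 1" if "v < n" for v
  proof -
    have "finite (s v)" "s v \<noteq> {}" using finB by (auto simp: s_def)
    moreover have "card (s v) \<le> d + 1"
      using cardB[OF that] finB card_image_le[OF finB, of "\<lambda>i. (idx i, l i v, r i v)" v]
      by (simp add: s_def card_insert_if)
    ultimately show ?thesis using list_of_set_length by metis
  qed
  then obtain c0 where c0: "\<And>v. v < n \<Longrightarrow> set (c0 v) = s v \<and> length (c0 v) = d + 1" by metis
  define c where "c = restrict c0 {..<n}"
  have c: "set (c v) = s v" "length (c v) = d + 1" if "v < n" for v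
    using c0[OF that] that by (auto simp: c_def)
  have BD: "i \<in> D" if "v < n" "i \<in> B v" for v i using that by (auto simp: D_def)
  have "s v \<subseteq> {..n * d} \<times> {..n} \<times> {..n}" if "v < n" for v
    using lr(1) idx_less BD[OF that] by (auto simp: s_def intro: less_imp_le)
  then have "c \<in> graph_codes n d"
    using c by (auto simp: graph_codes_def c_def)
  moreover have adj: "{u, v} \<in> E \<longleftrightarrow> compatible (c u) (c v)"
    if uv: "u < n" "v < n" "u \<noteq> v" for u v
  proof -
    have "{u, v} \<in> E \<longleftrightarrow> (\<forall>i<d'. I u i \<inter> I v i \<noteq> {})"
      using rep uv by (simp add: local_box_rep_def box_of_Int_nonempty_iff)
    also have "\<dots> \<longleftrightarrow> (\<forall>i\<in>B u \<inter> B v. I u i \<inter> I v i \<noteq> {})"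
    proof (intro iffI allI impI ballI)
      fix i assume *: "\<forall>i\<in>B u \<inter> B v. I u i \<inter> I v i \<noteq> {}" and i: "i < d'"
      show "I u i \<inter> I v i \<noteq> {}"
      proof (cases "i \<in> B u \<inter> B v")
        case False
        \<comment> \<open>One of the two factors is \<open>UNIV\<close> and the other is
          nonempty.\<close>
        then show ?thesis using ri[OF uv(1) i] ri[OF uv(2) i] i by (auto simp: B_def real_interval_def)
      qed (use * in blast)
    qed (auto simp: B_def)
    also have "\<dots> \<longleftrightarrow> (\<forall>i\<in>B u \<inter> B v. l i u \<le> r i v \<and> l i v \<le> r i u)"
      using lr(2)[OF uv(1,2)] by blast
    also have "\<dots> \<longleftrightarrow> compatible (c u) (c v)"
    proof
      assume *: "\<forall>i\<in>B u \<inter> B v. l i u \<le> r i v \<and> l i v \<le> r i u"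
      have same: "i = j" if "idx i = idx j" "i \<in> B u" "j \<in> B v" for i j
        using that inj_onD[OF idx] BD uv by blast
      \<comment> \<open>True indices are below \<open>n * d\<close>, so a dummy triple shares its
        index only with another dummy, and \<open>(0, 0)\<close> is compatible with itself.\<close>
      have dummy: "idx i \<noteq> n * d" if "i \<in> B u \<union> B v" for i
        using idx_less[of i] BD uv that by auto
      show "compatible (c u) (c v)"
        unfolding compatible_def
      proof (intro allI impI, elim conjE)
        fix j a b a' b' assume "(j, a, b) \<in> set (c u)" "(j, a', b') \<in> set (c v)"
        then have mem: "(j, a, b) = (n * d, 0, 0) \<or> (\<exists>i\<in>B u. (j, a, b) = (idx i, l i u, r i u))"
          "(j, a', b') = (n * d, 0, 0) \<or> (\<exists>i\<in>B v. (j, a', b') = (idx i, l i v, r i v))"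
          unfolding c(1)[OF uv(1)] c(1)[OF uv(2)] s_def by blast+
        show "a \<le> b' \<and> a' \<le> b"
        proof (cases "j = n * d")
          case True
          then have "(j, a, b) = (n * d, 0, 0)" "(j, a', b') = (n * d, 0, 0)" using mem dummy by force+
          then show ?thesis by simp
        next
          case False
          then obtain i k where "i \<in> B u" "(j, a, b) = (idx i, l i u, r i u)"
            "k \<in> B v" "(j, a', b') = (idx k, l k v, r k v)" using mem by auto
          then show ?thesis using same[of i k] * by auto
        qed
      qed
    next
      assume C: "compatible (c u) (c v)"
      show "\<forall>i\<in>B u \<inter> B v. l i u \<le> r i v \<and> l i v \<le> r i u"
      proof
        fix i assume "i \<in> B u \<inter> B v"
        then have "(idx i, l i u, r i u) \<in> set (c u)" "(idx i, l i v, r i v) \<in> set (c v)"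
          unfolding c(1)[OF uv(1)] c(1)[OF uv(2)] s_def by auto
        then show "l i u \<le> r i v \<and> l i v \<le> r i u" using C unfolding compatible_def by blast
      qed
    qed
    finally show ?thesis .
  qed
  moreover have "E = decode_graph n c"
  proof (intro equalityI subsetI)
    fix e assume e: "e \<in> E"
    then have "e \<subseteq> {..<n}" "card e = 2" using G by (auto simp: simple_graph_def)
    then obtain u v where "e = {u, v}" "u < n" "v < n" "u \<noteq> v" by (auto simp: card_2_iff)
    then show "e \<in> decode_graph n c" using adj[of u v] e unfolding decode_graph_def by blast
  next
    fix e assume "e \<in> decode_graph n c"
    then show "e \<in> E" using adj unfolding decode_graph_def by blast
  qed
  ultimately show ?thesis by blast
qed

lemma finite_labelled_graphs: "finite (labelled_graphs n k)"
  by (rule finite_subset[of _ "Pow (Pow {..<n})"]) (auto simp: labelled_graphs_def simple_graph_def)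

lemma card_labelled_graphs: "card (labelled_graphs n k) = (n choose 2) choose k"
proof -
  have "labelled_graphs n k = {E. E \<subseteq> {e. e \<subseteq> {..<n} \<and> card e = 2} \<and> card E = k}"
    by (auto simp: labelled_graphs_def simple_graph_def)
  then show ?thesis
    using n_subsets[of "{e. e \<subseteq> {..<n} \<and> card e = 2}" k] n_subsets[of "{..<n}" 2] by simp
qed

lemma card_lbox_le:
  "card {E \<in> labelled_graphs n k. lbox {..<n} E \<le> d} \<le> ((n * d + 1) * (n + 1)\<^sup>2) ^ ((d + 1) * n)"
proof -
  have "E \<in> decode_graph n ` graph_codes n d" if "simple_graph {..<n} E" "lbox {..<n} E \<le> d" for E
  proof -
    have "\<exists>d' I. local_box_rep (lbox {..<n} E) d' {..<n} E I"
      using LeastI_ex[OF local_box_rep_exists[OF that(1)]] unfolding lbox_def .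
    then show ?thesis using decode_graph_surj[OF that(1) _ that(2)] by blast
  qed
  then have "{E \<in> labelled_graphs n k. lbox {..<n} E \<le> d} \<subseteq> decode_graph n ` graph_codes n d"
    by (auto simp: labelled_graphs_def)
  then have "card {E \<in> labelled_graphs n k. lbox {..<n} E \<le> d} \<le> card (graph_codes n d)"
    by (rule surj_card_le[OF finite_graph_codes])
  then show ?thesis by (simp only: card_graph_codes)
qed

subsection \<open>Asymptotics\<close>

text \<open>The expression bounds the number of codes divided by the number of graphs. As
  \<open>ln (n + 1) / log 2 n\<close> tends to \<open>ln 2\<close>, the positive part of the
  exponent is asymptotic to \<open>\<epsilon> * ln 2 / 4 * n\<^sup>2\<close>, less than half of what
  is subtracted.\<close>

lemma exponent_limit:
  fixes \<epsilon> :: real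
  assumes "\<epsilon> > 0"
  shows "(\<lambda>n::nat. exp (4 * real n * (\<epsilon> / 16 * (real n / log 2 (real n)) + 1) * ln (real n + 1)
            - \<epsilon> * (real n)\<^sup>2)) \<longlonglongrightarrow> 0"
proof -
  have "(\<lambda>n::nat. 4 * real n * (\<epsilon> / 16 * (real n / log 2 (real n)) + 1) * ln (real n + 1) / (real n)\<^sup>2) \<longlonglongrightarrow> \<epsilon> * ln 2 / 4"
    using assms unfolding log_def by real_asymp
  moreover have "\<epsilon> * ln 2 / 4 < \<epsilon> / 2" using assms ln_2_less_1 by simp
  ultimately have ev: "\<forall>\<^sub>F n::nat in sequentially. 4 * real n * (\<epsilon> / 16 * (real n / log 2 (real n)) + 1) * ln (real n + 1) / (real n)\<^sup>2 < \<epsilon> / 2"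
    by (rule order_tendstoD)
  have "\<forall>\<^sub>F n::nat in sequentially. exp (4 * real n * (\<epsilon> / 16 * (real n / log 2 (real n)) + 1) * ln (real n + 1) - \<epsilon> * (real n)\<^sup>2)
       \<le> exp (- (\<epsilon> / 2 * (real n)\<^sup>2))"
    using ev eventually_gt_at_top[of 0]
  proof eventually_elim
    case (elim n)
    then show ?case by (simp add: divide_less_eq)
  qed
  then show ?thesis
  proof (rule tendsto_sandwich[OF _ _ tendsto_const, rotated])
    show "(\<lambda>n::nat. exp (- (\<epsilon> / 2 * (real n)\<^sup>2))) \<longlonglongrightarrow> 0"
      using assms by real_asymp
  qed simp
qed

text \<open>With \<open>N = n choose 2\<close>, the count \<open>N choose k\<close> is at least
  \<open>(N / k) ^ k\<close>, and \<open>N / k \<ge> 1 / (1 - \<delta>)\<close>. For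
  \<open>k\<close> of order \<open>n\<^sup>2\<close> this is exponential in
  \<open>n\<^sup>2\<close>.\<close>

lemma card_labelled_graphs_ge:
  assumes "0 < \<delta>" "\<delta> < 1" "k > 0" "real k \<le> (1 - \<delta>) * real (n choose 2)"
  shows "real (card (labelled_graphs n k)) \<ge> exp (- ln (1 - \<delta>) * real k)"
proof -
  define N where "N = n choose 2"
  have "(1 - \<delta>) * real N \<le> 1 * real N" using assms by (intro mult_right_mono) auto
  then have "real k \<le> real N" using assms(4) unfolding N_def by linarith
  have "exp (- ln (1 - \<delta>) * real k) = (1 / (1 - \<delta>)) ^ k"
    using assms by (simp add: exp_of_nat2_mult exp_minus inverse_eq_divide power_one_over)
  also have "\<dots> \<le> (real N / real k) ^ k"
    using assms by (intro power_mono) (auto simp: N_def field_simps)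
  also have "\<dots> \<le> real (N choose k)"
    using binomial_ge_n_over_k_pow_k[of k N, where ?'a = real] \<open>real k \<le> real N\<close> by simp
  finally show ?thesis by (simp add: card_labelled_graphs N_def)
qed

text \<open>For \<open>d \<le> n\<close> the base in \<open>card_lbox_le\<close> is at most
  \<open>(n + 1) ^ 4\<close>.\<close>

lemma card_lbox_le_exp:
  assumes "d \<le> n"
  shows "real (card {E \<in> labelled_graphs n k. lbox {..<n} E \<le> d})
           \<le> exp (4 * real n * (real d + 1) * ln (real n + 1))"
proof -
  have "n * d + 1 \<le> (n + 1)\<^sup>2"
  proof -
    have "n * d \<le> n * n" using assms by simp
    then show ?thesis unfolding power2_eq_square add_mult_distrib add_mult_distrib2 by linarith
  qed
  then have "(n * d + 1) * (n + 1)\<^sup>2 \<le> (n + 1)\<^sup>2 * (n + 1)\<^sup>2" by (rule mult_le_mono1)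
  then have "((n * d + 1) * (n + 1)\<^sup>2) ^ ((d + 1) * n) \<le> ((n + 1)\<^sup>2 * (n + 1)\<^sup>2) ^ ((d + 1) * n)"
    by (rule power_mono) simp
  also have "\<dots> = (n + 1) ^ (4 * n * (d + 1))"
    by (simp add: algebra_simps flip: power_mult power_add)
  finally have "card {E \<in> labelled_graphs n k. lbox {..<n} E \<le> d} \<le> (n + 1) ^ (4 * n * (d + 1))"
    using card_lbox_le le_trans by blast
  then have "real (card {E \<in> labelled_graphs n k. lbox {..<n} E \<le> d}) \<le> real ((n + 1) ^ (4 * n * (d + 1)))"
    by (simp only: of_nat_le_iff)
  also have "\<dots> = (real n + 1) ^ (4 * n * (d + 1))" by (simp add: add.commute)
  also have "\<dots> = exp (real (4 * n * (d + 1)) * ln (real n + 1))"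
    by (subst exp_of_nat_mult) simp
  also have "real (4 * n * (d + 1)) = 4 * real n * (real d + 1)" by (simp add: algebra_simps)
  finally show ?thesis .
qed

lemma almost_all_lbox_ge:
  fixes m :: "nat \<Rightarrow> nat"
  assumes "a > 0" "0 < \<delta>" "\<delta> < 1"
    and lower: "\<forall>\<^sub>F n in sequentially. a * (real n)\<^sup>2 \<le> real (m n)"
    and upper: "\<forall>\<^sub>F n in sequentially. real (m n) \<le> (1 - \<delta>) * real (n choose 2)"
  shows "\<exists>c>0. (\<lambda>n. real (card {E \<in> labelled_graphs n (m n).
                    real (lbox {..<n} E) \<ge> c * (sqrt (real (m n)) / log 2 (real (m n)))}) /
                real (card (labelled_graphs n (m n)))) \<longlonglongrightarrow> 1"
proof -
  \<comment> \<open>Chosen so that there are eventually at least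
    \<open>exp (\<epsilon> * n\<^sup>2)\<close> graphs; \<open>c = \<epsilon> / 16\<close> is the
    constant that \<open>exponent_limit\<close> tolerates.\<close>
  define \<epsilon> where "\<epsilon> = a * (- ln (1 - \<delta>))"
  have "\<epsilon> > 0" using assms unfolding \<epsilon>_def by (intro mult_pos_pos) auto
  define c where "c = \<epsilon> / 16"
  have "c > 0" using \<open>\<epsilon> > 0\<close> by (simp add: c_def)
  define q where "q n = c * (sqrt (real (m n)) / log 2 (real (m n)))" for n
  define bad where "bad n = {E \<in> labelled_graphs n (m n). real (lbox {..<n} E) < q n}" for n
  define p where "p n = real (card (bad n)) / real (card (labelled_graphs n (m n)))" for n
  define e where "e n = exp (4 * real n * (\<epsilon> / 16 * (real n / log 2 (real n)) + 1) * ln (real n + 1)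
            - \<epsilon> * (real n)\<^sup>2)" for n
  have "\<forall>\<^sub>F n::nat in sequentially. c * (real n / log 2 (real n)) \<le> real n"
    using \<open>c > 0\<close> unfolding log_def by real_asymp
  moreover have "\<forall>\<^sub>F n::nat in sequentially. real n \<le> a * (real n)\<^sup>2"
    using \<open>a > 0\<close> by real_asymp
  \<comment> \<open>Positivity of the denominator is recorded because division by 0 would yield 0,
    and \<open>1 - p n\<close> would not be the proportion of good graphs.\<close>
  ultimately have ev: "\<forall>\<^sub>F n in sequentially. p n \<le> e n \<and> card (labelled_graphs n (m n)) > 0"
    using lower upper eventually_gt_at_top[of 1]
  proof eventually_elim
    case (elim n)
    define d where "d = nat \<lfloor>c * (real n / log 2 (real n))\<rfloor>"
    have m: "real n \<le> real (m n)" using elim by linarith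
    have "0 \<le> c * (real n / log 2 (real n))" using elim \<open>c > 0\<close> by simp
    then have d: "real d \<le> c * (real n / log 2 (real n))" by (simp add: d_def)
    then have "d \<le> n" using elim by simp
    have "real (m n) \<le> (real n)\<^sup>2"
    proof -
      have "n choose 2 \<le> n\<^sup>2" by (cases "2 \<le> n") (simp_all add: binomial_le_pow binomial_eq_0)
      then have "real (n choose 2) \<le> (real n)\<^sup>2" by (metis of_nat_le_iff of_nat_power)
      moreover have "(1 - \<delta>) * real (n choose 2) \<le> 1 * real (n choose 2)"
        using assms by (intro mult_right_mono) auto
      ultimately show ?thesis using elim by linarith
    qed
    then have "sqrt (real (m n)) \<le> real n" by (simp add: real_le_lsqrt)
    moreover have "log 2 (real n) \<le> log 2 (real (m n))" "log 2 (real n) > 0" using m elim by simp_all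
    \<comment> \<open>The threshold in terms of \<open>m n\<close> is replaced by one in terms of
      \<open>n\<close>, whose floor is \<open>d\<close>; local boxicity is an integer, so bad graphs
      have at most \<open>d\<close>.\<close>
    ultimately have "q n \<le> c * (real n / log 2 (real n))"
      unfolding q_def using \<open>c > 0\<close> by (intro mult_left_mono frac_le) auto
    then have "bad n \<subseteq> {E \<in> labelled_graphs n (m n). lbox {..<n} E \<le> d}"
      by (auto simp: bad_def d_def le_nat_floor)
    then have "card (bad n) \<le> card {E \<in> labelled_graphs n (m n). lbox {..<n} E \<le> d}"
      by (rule card_mono[rotated]) (simp add: finite_labelled_graphs)
    then have "real (card (bad n)) \<le> exp (4 * real n * (real d + 1) * ln (real n + 1))"
      using card_lbox_le_exp[OF \<open>d \<le> n\<close>, of "m n"] by linarith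
    also have "\<dots> \<le> exp (4 * real n * (\<epsilon> / 16 * (real n / log 2 (real n)) + 1) * ln (real n + 1))"
      using d by (simp add: c_def mult_left_mono mult_right_mono)
    finally have bad: "real (card (bad n)) \<le> exp (4 * real n * (\<epsilon> / 16 * (real n / log 2 (real n)) + 1) * ln (real n + 1))" .
    have "m n > 0" using m elim by (cases "m n") auto
    have "\<epsilon> * (real n)\<^sup>2 = - ln (1 - \<delta>) * (a * (real n)\<^sup>2)" by (simp add: \<epsilon>_def)
    also have "\<dots> \<le> - ln (1 - \<delta>) * real (m n)" using assms elim by (intro mult_left_mono) auto
    finally have "exp (\<epsilon> * (real n)\<^sup>2) \<le> exp (- ln (1 - \<delta>) * real (m n))" by simp
    also have "\<dots> \<le> real (card (labelled_graphs n (m n)))"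
      using assms \<open>m n > 0\<close> elim by (intro card_labelled_graphs_ge) auto
    finally have total: "exp (\<epsilon> * (real n)\<^sup>2) \<le> real (card (labelled_graphs n (m n)))" .
    have "p n \<le> e n" unfolding p_def e_def exp_diff using bad total by (intro frac_le) auto
    moreover have "0 < exp (\<epsilon> * (real n)\<^sup>2)" by simp
    with total have "card (labelled_graphs n (m n)) > 0" by linarith
    ultimately show ?case by blast
  qed
  have "p \<longlonglongrightarrow> 0"
  proof (rule tendsto_sandwich[OF _ _ tendsto_const])
    show "\<forall>\<^sub>F n in sequentially. 0 \<le> p n" by (simp add: p_def)
    show "\<forall>\<^sub>F n in sequentially. p n \<le> e n" using ev by (rule eventually_mono) blast
    show "e \<longlonglongrightarrow> 0" unfolding e_def by (rule exponent_limit[OF \<open>\<epsilon> > 0\<close>])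
  qed
  then have "(\<lambda>n. 1 - p n) \<longlonglongrightarrow> 1 - 0" by (intro tendsto_intros)
  moreover have "\<forall>\<^sub>F n in sequentially. 1 - p n =
     real (card {E \<in> labelled_graphs n (m n). real (lbox {..<n} E) \<ge> q n}) / real (card (labelled_graphs n (m n)))"
    using ev
  proof eventually_elim
    case (elim n)
    define good where "good = {E \<in> labelled_graphs n (m n). real (lbox {..<n} E) \<ge> q n}"
    have "labelled_graphs n (m n) = good \<union> bad n" "good \<inter> bad n = {}" by (auto simp: good_def bad_def)
    then have "card (labelled_graphs n (m n)) = card good + card (bad n)"
      using card_Un_disjoint[of good "bad n"] finite_labelled_graphs by (metis finite_Un)
    then have "real (card good) = real (card (labelled_graphs n (m n))) - real (card (bad n))" by simp
    then have "1 - p n = real (card good) / real (card (labelled_graphs n (m n)))"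
      using elim by (simp add: p_def diff_divide_distrib)
    then show ?case by (simp add: good_def)
  qed
  ultimately have "(\<lambda>n. real (card {E \<in> labelled_graphs n (m n). real (lbox {..<n} E) \<ge> q n}) /
      real (card (labelled_graphs n (m n)))) \<longlonglongrightarrow> 1"
    using Lim_transform_eventually by force
  then show ?thesis using \<open>c > 0\<close> unfolding q_def by blast
qed

text \<open>Eventually \<open>n \<le> m n \<le> n ^ 3\<close>, so \<open>log 2 (m n)\<close> lies
  between \<open>log 2 n\<close> and \<open>3 * log 2 n\<close>. This gives the second form of the
  lower bound.\<close>

lemma sqrt_div_log_bigtheta:
  fixes m :: "nat \<Rightarrow> nat"
  assumes "a > 0" "b > 0"
    and lower: "\<forall>\<^sub>F n in sequentially. a * (real n)\<^sup>2 \<le> real (m n)"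
    and upper: "\<forall>\<^sub>F n in sequentially. real (m n) \<le> b * (real n)\<^sup>2"
  shows "(\<lambda>n. sqrt (real (m n)) / log 2 (real (m n))) \<in> \<Theta>(\<lambda>n. real n / log 2 (real n))"
proof (rule bigtheta_divide)
  have "\<forall>\<^sub>F n in sequentially. norm (sqrt (real (m n))) \<le> sqrt b * norm (real n)"
    using upper
  proof eventually_elim
    case (elim n)
    then have "sqrt (real (m n)) \<le> sqrt (b * (real n)\<^sup>2)" by simp
    then show ?case by (simp add: real_sqrt_mult)
  qed
  moreover have "\<forall>\<^sub>F n in sequentially. norm (sqrt (real (m n))) \<ge> sqrt a * norm (real n)"
    using lower
  proof eventually_elim
    case (elim n)
    then have "sqrt (a * (real n)\<^sup>2) \<le> sqrt (real (m n))" by simp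
    then show ?case by (simp add: real_sqrt_mult)
  qed
  ultimately show "(\<lambda>n. sqrt (real (m n))) \<in> \<Theta>(\<lambda>n. real n)"
    using assms(1,2) by (intro bigthetaI landau_o.bigI[of "sqrt b"] landau_omega.bigI[of "sqrt a"]) auto
  have "\<forall>\<^sub>F n::nat in sequentially. real n \<le> a * (real n)\<^sup>2" "\<forall>\<^sub>F n::nat in sequentially. b * (real n)\<^sup>2 \<le> real n ^ 3"
    using \<open>a > 0\<close> \<open>b > 0\<close> by real_asymp+
  then have *: "\<forall>\<^sub>F n in sequentially. 0 \<le> log 2 (real n) \<and> log 2 (real n) \<le> log 2 (real (m n)) \<and> log 2 (real (m n)) \<le> 3 * log 2 (real n)"
    using lower upper eventually_gt_at_top[of 1]
  proof eventually_elim
    case (elim n)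
    have "real n \<le> real (m n)" "real (m n) \<le> real n ^ 3" using elim by linarith+
    moreover have "log 2 (real n ^ 3) = 3 * log 2 (real n)" using elim by (simp add: log_nat_power)
    moreover have "log 2 (real (m n)) \<le> log 2 (real n ^ 3)" using calculation(1,2) elim by simp
    ultimately show ?case using elim by simp
  qed
  show "(\<lambda>n. log 2 (real (m n))) \<in> \<Theta>(\<lambda>n. log 2 (real n))"
  proof (intro bigthetaI)
    show "(\<lambda>n. log 2 (real (m n))) \<in> O(\<lambda>n. log 2 (real n))"
      by (rule landau_o.bigI[of 3]) (use * in \<open>auto elim!: eventually_mono\<close>)
    show "(\<lambda>n. log 2 (real (m n))) \<in> \<Omega>(\<lambda>n. log 2 (real n))"
      by (rule landau_omega.bigI[of 1]) (use * in \<open>auto elim!: eventually_mono\<close>)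
  qed
qed

theorem theorem1p2:
  shows
    "(\<exists>C\<^sub>3>0. \<forall>(V :: nat set) (E :: nat set set) (m :: nat).
        simple_graph V E \<and> card E = m \<and> m \<ge> 1 \<longrightarrow> real (lbox V E) \<le> C\<^sub>3 * sqrt (real m)) \<and>
     (\<forall>m :: nat \<Rightarrow> nat.
        (\<lambda>n. real (m n)) \<in> \<Theta>(\<lambda>n. (real n)\<^sup>2) \<and>
        (\<exists>\<delta>>0. \<forall>\<^sub>F n in sequentially. real (m n) \<le> (1 - \<delta>) * real (n choose 2)) \<longrightarrow>
        (\<exists>c>0.
           (\<lambda>n. real (card {E \<in> labelled_graphs n (m n).
                    real (lbox {..<n} E) \<ge> c * (sqrt (real (m n)) / log 2 (real (m n)))}) /
                real (card (labelled_graphs n (m n)))) \<longlonglongrightarrow> 1) \<and>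
        \<Omega>(\<lambda>n. sqrt (real (m n)) / log 2 (real (m n))) = \<Omega>(\<lambda>n. real n / log 2 (real n)))"
proof (intro conjI allI impI)
  have "real (lbox V E) \<le> 57 * sqrt (real m)" if "simple_graph V E \<and> card E = m \<and> m \<ge> 1"
    for V :: "nat set" and E m
    using lbox_le_sqrt_edges[of V E] that by blast
  then show "\<exists>C\<^sub>3>0. \<forall>(V :: nat set) (E :: nat set set) (m :: nat).
      simple_graph V E \<and> card E = m \<and> m \<ge> 1 \<longrightarrow> real (lbox V E) \<le> C\<^sub>3 * sqrt (real m)"
    by (intro exI[of _ 57]) auto
next
  fix m :: "nat \<Rightarrow> nat"
  assume m: "(\<lambda>n. real (m n)) \<in> \<Theta>(\<lambda>n. (real n)\<^sup>2) \<and>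
    (\<exists>\<delta>>0. \<forall>\<^sub>F n in sequentially. real (m n) \<le> (1 - \<delta>) * real (n choose 2))"
  then have "(\<lambda>n. real (m n)) \<in> O(\<lambda>n. (real n)\<^sup>2)" "(\<lambda>n. real (m n)) \<in> \<Omega>(\<lambda>n. (real n)\<^sup>2)"
    by auto
  then obtain a b where a: "a > 0" "\<forall>\<^sub>F n in sequentially. a * (real n)\<^sup>2 \<le> real (m n)"
    and b: "b > 0" "\<forall>\<^sub>F n in sequentially. real (m n) \<le> b * (real n)\<^sup>2"
    by (elim landau_o.bigE landau_omega.bigE) simp
  from m obtain \<delta>\<^sub>0 where \<delta>\<^sub>0: "\<delta>\<^sub>0 > 0" "\<forall>\<^sub>F n in sequentially. real (m n) \<le> (1 - \<delta>\<^sub>0) * real (n choose 2)"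
    by blast
  \<comment> \<open>The cap at \<open>1 / 2\<close> keeps \<delta> below 1, as
    \<open>ln (1 - \<delta>)\<close> requires; decreasing \<delta> only weakens the bound on
    \<open>m n\<close>.\<close>
  define \<delta> where "\<delta> = min \<delta>\<^sub>0 (1 / 2)"
  have \<delta>: "0 < \<delta>" "\<delta> < 1" using \<delta>\<^sub>0(1) by (auto simp: \<delta>_def)
  have "(1 - \<delta>\<^sub>0) * real (n choose 2) \<le> (1 - \<delta>) * real (n choose 2)" for n
    by (intro mult_right_mono) (auto simp: \<delta>_def)
  then have "\<forall>\<^sub>F n in sequentially. real (m n) \<le> (1 - \<delta>) * real (n choose 2)"
    using \<delta>\<^sub>0(2) by (auto elim!: eventually_mono intro: order_trans)
  with a \<delta> show "\<exists>c>0.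
      (\<lambda>n. real (card {E \<in> labelled_graphs n (m n).
                real (lbox {..<n} E) \<ge> c * (sqrt (real (m n)) / log 2 (real (m n)))}) /
            real (card (labelled_graphs n (m n)))) \<longlonglongrightarrow> 1"
    by (intro almost_all_lbox_ge)
  show "\<Omega>(\<lambda>n. sqrt (real (m n)) / log 2 (real (m n))) = \<Omega>(\<lambda>n. real n / log 2 (real n))"
    by (intro landau_omega.big.cong_bigtheta sqrt_div_log_bigtheta[OF a(1) b(1) a(2) b(2)])
qed

end
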